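(* Let $n\in\mathbb{N}$, let $H$ be a $2^{n}\times 2^{n}$ Hermitian matrix with minimum eigenvalue (ground-state energy) $\lambda_{\min}(H)$, let $\Theta$ be a parameter set, and let $\{\omega(\theta)\}_{\theta\in\Theta}$ be a parametrized set of $2^n\times 2^n$ density matrices. For $\eta\in\mathbb{R}$, $\nu\geq 0$, $\theta\in\Theta$ and $c>0$, define $$f(\eta,\nu,\theta,c)= \eta-c\Big(\operatorname{Tr}[H^{2}]+\eta^{2}2^{n}+\nu^{2}\operatorname{Tr}[\omega(\theta)^{2}]-2\eta\operatorname{Tr}[H]-2\nu\operatorname{Tr}[H\omega(\theta)]+2\eta\nu\Big),$$ and $$f^{\ast}(c)=\sup_{\eta\in\mathbb{R},\ \nu\geq 0,\ \theta\in\Theta} f(\eta,\nu,\theta,c).$$ Then $$\lim_{c\to\infty} f^{\ast}(c)\leq\lambda_{\min}(H).$$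
   Context: A density matrix is a positive semidefinite (Hermitian) complex matrix with trace equal to one. The parametrized set $\{\omega(\theta)\}_{\theta\in\Theta}$ is an arbitrary family of density matrices indexed by $\Theta$; it need not contain all density matrices. The expression in parentheses multiplied by $c$ is $\left\Vert H-\eta I-\nu\omega(\theta)\right\Vert_2^2$, where $\left\Vert Z\right\Vert_2=\sqrt{\operatorname{Tr}[Z^{\dagger}Z]}$ is the Hilbert--Schmidt norm and $I$ is the $2^n\times 2^n$ identity matrix. Suprema and the limit are understood in the extended real numbers $[-\infty,+\infty]$. *)

theory Defs
  imports
    "Jordan_Normal_Form.Schur_Decomposition"
    "Jordan_Normal_Form.Spectral_Radius"
    "HOL-Library.Extended_Real"
begin

definition mat_trace :: "complex mat \<Rightarrow> complex" where
  "mat_trace A = (\<Sum>i<dim_row A. A $$ (i, i))"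

definition hermitian_mat :: "complex mat \<Rightarrow> bool" where
  "hermitian_mat A \<longleftrightarrow> square_mat A \<and> mat_adjoint A = A"

(* The quadratic form of a Hermitian matrix is real, so Re discards nothing here. *)
definition psd_mat :: "complex mat \<Rightarrow> bool" where
  "psd_mat A \<longleftrightarrow> hermitian_mat A \<and>
     (\<forall>v \<in> carrier_vec (dim_row A). 0 \<le> Re ((A *\<^sub>v v) \<bullet>c v))"

definition density_mat :: "complex mat \<Rightarrow> bool" where
  "density_mat A \<longleftrightarrow> psd_mat A \<and> mat_trace A = 1"

(* Intended for a Hermitian matrix of positive dimension: its spectrum is finite, nonempty
   and real, so Re merely converts the eigenvalues from complex to real. *)
definition lambda_min :: "complex mat \<Rightarrow> real" where
  "lambda_min A = Min (Re ` spectrum A)"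

lemma mat_trace_mult_hermitian_real:
  assumes "A \<in> carrier_mat d d" "B \<in> carrier_mat d d" "hermitian_mat A" "hermitian_mat B"
  shows "mat_trace (A * B) \<in> \<real>"
proof -
  have entry: "cnj (M $$ (i, j)) = M $$ (j, i)"
    if M: "M \<in> carrier_mat d d" "hermitian_mat M" and ij: "i < d" "j < d" for M i j
  proof -
    have "M $$ (j, i) = mat_adjoint M $$ (j, i)"
      using M by (simp add: hermitian_mat_def)
    also have "\<dots> = cnj (M $$ (i, j))"
      using M ij by (simp add: mat_adjoint_def mat_of_rows_def)
    finally show ?thesis by simp
  qed
  have tr: "mat_trace (A * B) = (\<Sum>i<d. \<Sum>k<d. A $$ (i, k) * B $$ (k, i))"
    using assms(1,2) by (auto simp: mat_trace_def scalar_prod_def atLeast0LessThan intro!: sum.cong)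
  have "cnj (mat_trace (A * B)) = (\<Sum>i<d. \<Sum>k<d. A $$ (k, i) * B $$ (i, k))"
    using assms by (simp add: tr entry)
  also have "\<dots> = mat_trace (A * B)"
    unfolding tr by (rule sum.swap)
  finally show ?thesis by (simp add: Reals_cnj_iff)
qed

(* For Hermitian arguments all four traces below are real; for the products this is
   mat_trace_mult_hermitian_real. *)
definition penalty_obj ::
  "nat \<Rightarrow> complex mat \<Rightarrow> ('t \<Rightarrow> complex mat) \<Rightarrow> real \<Rightarrow> real \<Rightarrow> 't \<Rightarrow> real \<Rightarrow> real" where
  "penalty_obj n H \<omega> \<eta> \<nu> \<theta> c =
     \<eta> - c * (Re (mat_trace (H ^\<^sub>m 2)) + \<eta>\<^sup>2 * 2 ^ n + \<nu>\<^sup>2 * Re (mat_trace (\<omega> \<theta> ^\<^sub>m 2))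
              - 2 * \<eta> * Re (mat_trace H) - 2 * \<nu> * Re (mat_trace (H * \<omega> \<theta>)) + 2 * \<eta> * \<nu>)"

definition penalty_sup ::
  "nat \<Rightarrow> complex mat \<Rightarrow> 't set \<Rightarrow> ('t \<Rightarrow> complex mat) \<Rightarrow> real \<Rightarrow> ereal" where
  "penalty_sup n H \<Theta> \<omega> c =
     (SUP (\<eta>, \<nu>, \<theta>) \<in> UNIV \<times> {0..} \<times> \<Theta>. ereal (penalty_obj n H \<omega> \<eta> \<nu> \<theta> c))"

end

theory Submission
  imports Defs "HOL-Analysis.L2_Norm" "HOL-Real_Asymp.Real_Asymp"
begin

text \<open>
  Let \<open>M = H - \<eta> I - \<nu> \<omega>\<close> and let \<open>v\<close> be an eigenvector of \<open>H\<close> for its smallest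
  eigenvalue \<open>\<lambda>\<close>. As \<open>\<omega>\<close> is positive semidefinite and \<open>\<nu> \<ge> 0\<close>, the quadratic form of \<open>M\<close> at
  \<open>v\<close> is at most \<open>(\<lambda> - \<eta>) |v|^2\<close>, whereas Cauchy--Schwarz bounds it below by \<open>- |M| |v|^2\<close>,
  where \<open>|M|\<close> is the Hilbert--Schmidt norm. So \<open>\<eta> - \<lambda> \<le> |M|\<close>, and the objective
  \<open>\<eta> - c |M|^2\<close> is at most \<open>\<lambda> + x - c x^2 \<le> \<lambda> + 1 / (4 c)\<close> with \<open>x = |M|\<close>. The supremum is
  nonincreasing in \<open>c\<close>, so its limit exists.
\<close>

lemma hermitian_mat_cnj_index:
  assumes "A \<in> carrier_mat d d" "hermitian_mat A" "i < d" "j < d"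
  shows "cnj (A $$ (i, j)) = A $$ (j, i)"
proof -
  have "A $$ (j, i) = mat_adjoint A $$ (j, i)"
    using assms by (simp add: hermitian_mat_def)
  also have "\<dots> = cnj (A $$ (i, j))"
    using assms by (simp add: mat_adjoint_def mat_of_rows_def)
  finally show ?thesis by simp
qed

text \<open>Hermiticity of \<open>B\<close> turns the factor \<open>B $$ (j, i)\<close> of the trace
  into \<open>cnj (B $$ (i, j))\<close>, which leaves the real Hilbert--Schmidt inner product as an
  entrywise sum.\<close>

lemma Re_mat_trace_mult_hermitian:
  assumes "A \<in> carrier_mat d d" "B \<in> carrier_mat d d" "hermitian_mat B"
  shows "Re (mat_trace (A * B)) = (\<Sum>i<d. \<Sum>j<d. Re (A $$ (i, j) * cnj (B $$ (i, j))))"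
  using assms
  by (auto simp: mat_trace_def scalar_prod_def atLeast0LessThan hermitian_mat_cnj_index Re_sum
      simp del: times_complex.sel intro!: sum.cong)

lemma cscalar_prod_mult_mat_vec:
  assumes "A \<in> carrier_mat d d" "v \<in> carrier_vec d"
  shows "(A *\<^sub>v v) \<bullet>c v = (\<Sum>i<d. \<Sum>j<d. A $$ (i, j) * v $ j * cnj (v $ i))"
  using assms
  by (auto simp: scalar_prod_def atLeast0LessThan sum_distrib_right intro!: sum.cong)

lemma smult_mat_mult_vec:
  fixes A :: "'a::comm_ring_1 mat"
  assumes "v \<in> carrier_vec (dim_col A)"
  shows "(k \<cdot>\<^sub>m A) *\<^sub>v v = k \<cdot>\<^sub>v (A *\<^sub>v v)"
  using assms by (intro eq_vecI) auto

definition penalty_residual :: "complex mat \<Rightarrow> complex mat \<Rightarrow> real \<Rightarrow> real \<Rightarrow> complex mat" where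
  "penalty_residual H W \<eta> \<nu> =
     H - complex_of_real \<eta> \<cdot>\<^sub>m 1\<^sub>m (dim_row H) - complex_of_real \<nu> \<cdot>\<^sub>m W"

text \<open>The trace of \<open>mat_adjoint A * A\<close>, written entrywise so that it is visibly
  nonnegative and open to Cauchy--Schwarz over index pairs.\<close>

definition hs_norm_sq :: "complex mat \<Rightarrow> real" where
  "hs_norm_sq A = (\<Sum>i<dim_row A. \<Sum>j<dim_col A. (cmod (A $$ (i, j)))\<^sup>2)"

lemma hs_norm_sq_nonneg: "0 \<le> hs_norm_sq A"
  by (simp add: hs_norm_sq_def sum_nonneg)

lemma sum_diagonal:
  "(\<Sum>i<d. \<Sum>j<d. if i = j then g i else 0) = (\<Sum>i<d. g i)"
  for d :: nat and g :: "nat \<Rightarrow> 'a::comm_monoid_add"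
  by (rule sum.cong) auto

text \<open>Identifies the penalty as a squared norm. The cross term of the identity with
  \<open>W\<close> is \<open>2 * \<eta> * \<nu>\<close> times the trace of \<open>W\<close>, which
  is where trace one enters.\<close>

lemma hs_norm_sq_penalty_residual:
  assumes H: "H \<in> carrier_mat d d" "hermitian_mat H"
    and W: "W \<in> carrier_mat d d" "hermitian_mat W" and tr: "mat_trace W = 1"
  shows "hs_norm_sq (penalty_residual H W \<eta> \<nu>) =
    Re (mat_trace (H ^\<^sub>m 2)) + \<eta>\<^sup>2 * d + \<nu>\<^sup>2 * Re (mat_trace (W ^\<^sub>m 2))
      - 2 * \<eta> * Re (mat_trace H) - 2 * \<nu> * Re (mat_trace (H * W)) + 2 * \<eta> * \<nu>"
proof -
  have sq: "A ^\<^sub>m 2 = A * A" if "A \<in> carrier_mat d d" for A :: "complex mat"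
    using that by (simp add: numeral_2_eq_2)
  \<comment> \<open>The square is expanded entry by entry. The identity matrix contributes on the
    diagonal only; these conditionals later collapse to single sums by
    \<open>sum_diagonal\<close>.\<close>
  have entry: "(cmod (penalty_residual H W \<eta> \<nu> $$ (i, j)))\<^sup>2 =
      Re (H $$ (i, j) * cnj (H $$ (i, j))) + (if i = j then \<eta>\<^sup>2 else 0)
      + \<nu>\<^sup>2 * Re (W $$ (i, j) * cnj (W $$ (i, j)))
      - 2 * \<eta> * (if i = j then Re (H $$ (i, i)) else 0)
      - 2 * \<nu> * Re (H $$ (i, j) * cnj (W $$ (i, j)))
      + 2 * \<eta> * \<nu> * (if i = j then Re (W $$ (i, i)) else 0)" if "i < d" "j < d" for i j
    unfolding cmod_power2 using that H W
    by (auto simp: penalty_residual_def power2_eq_square algebra_simps)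
  have trW: "(\<Sum>i<d. Re (W $$ (i, i))) = 1"
    using tr W by (simp add: mat_trace_def flip: Re_sum)
  have trH: "(\<Sum>i<d. Re (H $$ (i, i))) = Re (mat_trace H)"
    using H by (simp add: mat_trace_def)
  have "hs_norm_sq (penalty_residual H W \<eta> \<nu>) =
      (\<Sum>i<d. \<Sum>j<d. (cmod (penalty_residual H W \<eta> \<nu> $$ (i, j)))\<^sup>2)"
    using H W by (simp add: hs_norm_sq_def penalty_residual_def)
  also have "\<dots> = Re (mat_trace (H * H)) + \<eta>\<^sup>2 * d + \<nu>\<^sup>2 * Re (mat_trace (W * W))
      - 2 * \<eta> * Re (mat_trace H) - 2 * \<nu> * Re (mat_trace (H * W)) + 2 * \<eta> * \<nu>"
    unfolding Re_mat_trace_mult_hermitian[OF H(1) H] Re_mat_trace_mult_hermitian[OF W(1) W]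
      Re_mat_trace_mult_hermitian[OF H(1) W]
    by (simp add: entry sum.distrib sum_subtractf sum_diagonal trW trH
        del: times_complex.sel flip: sum_distrib_left)
  finally show ?thesis
    using H W by (simp add: sq)
qed

text \<open>Cauchy--Schwarz over pairs of indices, pairing the moduli of the entries of
  \<open>A\<close> with those of the rank-one matrix built from \<open>v\<close>, whose
  Hilbert--Schmidt norm is the squared norm of \<open>v\<close>.\<close>

lemma cmod_quadratic_form_le:
  assumes A: "A \<in> carrier_mat d d" and v: "v \<in> carrier_vec d"
  shows "cmod ((A *\<^sub>v v) \<bullet>c v) \<le> sqrt (hs_norm_sq A) * Re (v \<bullet>c v)"
proof -
  let ?I = "{..<d} \<times> {..<d}"
  let ?a = "\<lambda>(i, j). cmod (A $$ (i, j))" and ?b = "\<lambda>(i, j). cmod (v $ j) * cmod (v $ i)"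
  define s where "s = (\<Sum>i<d. (cmod (v $ i))\<^sup>2)"
  have s: "Re (v \<bullet>c v) = s"
    unfolding s_def cmod_power2
    using v by (simp add: scalar_prod_def atLeast0LessThan power2_eq_square)
  have "cmod ((A *\<^sub>v v) \<bullet>c v) \<le> (\<Sum>i<d. \<Sum>j<d. cmod (A $$ (i, j)) * (cmod (v $ j) * cmod (v $ i)))"
    unfolding cscalar_prod_mult_mat_vec[OF A v]
    by (intro order.trans[OF norm_sum] sum_mono) (simp add: norm_mult mult.assoc)
  also have "\<dots> = (\<Sum>p\<in>?I. ?a p * ?b p)"
    by (simp add: sum.cartesian_product split_def)
  also have "\<dots> \<le> L2_set ?a ?I * L2_set ?b ?I"
    using L2_set_mult_ineq[of ?a ?b ?I] by (simp add: split_def)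
  also have "L2_set ?a ?I = sqrt (hs_norm_sq A)"
    using A by (simp add: L2_set_def hs_norm_sq_def sum.cartesian_product split_def)
  also have "L2_set ?b ?I = s"
  proof -
    \<comment> \<open>The summand is a product of a function of \<open>i\<close> and the same
      function of \<open>j\<close>, so the double sum factors.\<close>
    have "(\<Sum>p\<in>?I. (?b p)\<^sup>2) = s\<^sup>2"
      by (simp add: s_def power2_eq_square[of "sum _ _"] sum_product sum.cartesian_product
          split_def power_mult_distrib mult.commute)
    moreover have "0 \<le> s" by (simp add: s_def sum_nonneg)
    ultimately show ?thesis by (simp add: L2_set_def)
  qed
  finally show ?thesis by (simp add: s)
qed

text \<open>Positive dimension makes the finite spectrum nonempty, so the \<open>Min\<close> in
  \<open>lambda_min\<close> is attained.\<close>

lemma lambda_min_eigenvector: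
  assumes "H \<in> carrier_mat d d" "d > 0"
  obtains \<mu> v where "eigenvector H v \<mu>" "Re \<mu> = lambda_min H"
proof -
  have "lambda_min H \<in> Re ` spectrum H"
    unfolding lambda_min_def
    using card_finite_spectrum(1)[OF assms(1)] spectrum_non_empty[OF assms] by (intro Min_in) auto
  then show ?thesis
    using that by (auto simp: spectrum_def eigenvalue_def)
qed

lemma eta_le_hs_norm_penalty_residual:
  assumes H: "H \<in> carrier_mat d d" and W: "W \<in> carrier_mat d d" "psd_mat W"
    and "d > 0" "0 \<le> \<nu>"
  shows "\<eta> - lambda_min H \<le> sqrt (hs_norm_sq (penalty_residual H W \<eta> \<nu>))"
proof -
  obtain \<mu> v where ev: "eigenvector H v \<mu>" and \<mu>: "Re \<mu> = lambda_min H"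
    using lambda_min_eigenvector[OF H \<open>d > 0\<close>] .
  have v: "v \<in> carrier_vec d" "v \<noteq> 0\<^sub>v d" and Hv: "H *\<^sub>v v = \<mu> \<cdot>\<^sub>v v"
    using ev H by (auto simp: eigenvector_def)
  let ?M = "penalty_residual H W \<eta> \<nu>" and ?s = "Re (v \<bullet>c v)"
  have M: "?M \<in> carrier_mat d d"
    using H W by (auto simp: penalty_residual_def)
  \<comment> \<open>This is the order on complex numbers: it gives a positive real part and a
    vanishing imaginary part at once.\<close>
  have s: "0 < v \<bullet>c v"
    using conjugate_square_greater_0_vec[OF v(1)] v(2) by simp
  then have s_pos: "0 < ?s" and s_real: "Im (v \<bullet>c v) = 0"
    by (auto simp: less_complex_def)
  have "?M *\<^sub>v v = \<mu> \<cdot>\<^sub>v v - complex_of_real \<eta> \<cdot>\<^sub>v v - complex_of_real \<nu> \<cdot>\<^sub>v (W *\<^sub>v v)"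
    using H W v Hv
    by (simp add: penalty_residual_def minus_mult_distrib_mat_vec[of _ d d] smult_mat_mult_vec
        minus_carrier_mat[of _ d d])
  then have "(?M *\<^sub>v v) \<bullet>c v =
      (\<mu> - complex_of_real \<eta>) * (v \<bullet>c v) - complex_of_real \<nu> * ((W *\<^sub>v v) \<bullet>c v)"
    using W v by (simp add: minus_scalar_prod_distrib[of _ d] algebra_simps)
  \<comment> \<open>Since \<open>v \<bullet>c v\<close> is real, only the real part of
    \<open>\<mu>\<close> survives.\<close>
  then have "Re ((?M *\<^sub>v v) \<bullet>c v) = (lambda_min H - \<eta>) * ?s - \<nu> * Re ((W *\<^sub>v v) \<bullet>c v)"
    by (simp add: \<mu> s_real)
  moreover have "0 \<le> \<nu> * Re ((W *\<^sub>v v) \<bullet>c v)"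
    using W v \<open>0 \<le> \<nu>\<close> by (simp add: psd_mat_def)
  ultimately have "(\<eta> - lambda_min H) * ?s \<le> - Re ((?M *\<^sub>v v) \<bullet>c v)"
    by (simp add: algebra_simps)
  also have "\<dots> \<le> cmod ((?M *\<^sub>v v) \<bullet>c v)"
    using abs_Re_le_cmod[of "(?M *\<^sub>v v) \<bullet>c v"] by linarith
  also have "\<dots> \<le> sqrt (hs_norm_sq ?M) * ?s"
    by (rule cmod_quadratic_form_le[OF M v(1)])
  finally show ?thesis
    using s_pos by simp
qed

text \<open>Completing the square: the gap is \<open>(2 * c * x - 1)\<^sup>2 / (4 * c)\<close>, zero
  at the maximiser \<open>x = 1 / (2 * c)\<close>.\<close>

lemma linear_minus_square_le:
  fixes x c :: real
  assumes "0 < c"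
  shows "x - c * x\<^sup>2 \<le> 1 / (4 * c)"
proof -
  have "0 \<le> (2 * c * x - 1)\<^sup>2 / (4 * c)"
    using assms by simp
  also have "\<dots> = 1 / (4 * c) - (x - c * x\<^sup>2)"
    using assms by (simp add: power2_eq_square field_simps)
  finally show ?thesis by simp
qed

text \<open>Monotone convergence in the order topology: the infimum bounds every value from below,
  and any point whose value is below \<open>u\<close> keeps all later values below
  \<open>u\<close>.\<close>

lemma antimono_tendsto_INF_at_top:
  fixes F :: "real \<Rightarrow> 'a::{complete_linorder, linorder_topology}"
  assumes anti: "\<And>x y. a < x \<Longrightarrow> x \<le> y \<Longrightarrow> F y \<le> F x"
  shows "(F \<longlongrightarrow> (INF x\<in>{a<..}. F x)) at_top"
proof (rule order_tendstoI)
  fix l assume "l < (INF x\<in>{a<..}. F x)"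
  then have "l < F x" if "a < x" for x
    using that by (meson INF_lower greaterThan_iff less_le_trans)
  then show "\<forall>\<^sub>F x in at_top. l < F x"
    by (rule eventually_mono[OF eventually_gt_at_top[of a]])
next
  fix u assume "(INF x\<in>{a<..}. F x) < u"
  then obtain x where "a < x" "F x < u"
    by (auto simp: INF_less_iff)
  then show "\<forall>\<^sub>F y in at_top. F y < u"
    by (blast intro: eventually_mono[OF eventually_ge_at_top[of x]] le_less_trans[OF anti])
qed

theorem theorem1:
  fixes n :: nat and H :: "complex mat" and \<Theta> :: "'t set" and \<omega> :: "'t \<Rightarrow> complex mat"
  assumes "H \<in> carrier_mat (2 ^ n) (2 ^ n)" and "hermitian_mat H"
    and "\<And>\<theta>. \<theta> \<in> \<Theta> \<Longrightarrow> \<omega> \<theta> \<in> carrier_mat (2 ^ n) (2 ^ n)"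
    and "\<And>\<theta>. \<theta> \<in> \<Theta> \<Longrightarrow> density_mat (\<omega> \<theta>)"
  shows "\<exists>L. ((\<lambda>c. penalty_sup n H \<Theta> \<omega> c) \<longlongrightarrow> L) at_top \<and> L \<le> ereal (lambda_min H)"
proof -
  let ?F = "penalty_sup n H \<Theta> \<omega>"
  let ?Q = "\<lambda>\<eta> \<nu> \<theta>. hs_norm_sq (penalty_residual H (\<omega> \<theta>) \<eta> \<nu>)"
  have psd: "psd_mat (\<omega> \<theta>)" if "\<theta> \<in> \<Theta>" for \<theta>
    using assms(4)[OF that] by (simp add: density_mat_def)
  have obj: "penalty_obj n H \<omega> \<eta> \<nu> \<theta> c = \<eta> - c * ?Q \<eta> \<nu> \<theta>" if "\<theta> \<in> \<Theta>" for \<eta> \<nu> \<theta> c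
    using that psd assms
    by (subst hs_norm_sq_penalty_residual[of _ "2 ^ n"])
      (auto simp: penalty_obj_def psd_mat_def density_mat_def)
  have anti: "?F c' \<le> ?F c" if "c \<le> c'" for c c'
    unfolding penalty_sup_def
  proof (rule SUP_mono)
    fix p :: "real \<times> real \<times> 't"
    assume p: "p \<in> UNIV \<times> {0..} \<times> \<Theta>"
    obtain \<eta> \<nu> \<theta> where [simp]: "p = (\<eta>, \<nu>, \<theta>)" by (cases p)
    \<comment> \<open>The same triple serves for both parameters, since a larger \<open>c\<close>
      subtracts a larger multiple of a nonnegative penalty.\<close>
    have "c * ?Q \<eta> \<nu> \<theta> \<le> c' * ?Q \<eta> \<nu> \<theta>"
      using that by (intro mult_right_mono hs_norm_sq_nonneg)
    then show "\<exists>q\<in>UNIV \<times> {0..} \<times> \<Theta>.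
        (case p of (\<eta>, \<nu>, \<theta>) \<Rightarrow> ereal (penalty_obj n H \<omega> \<eta> \<nu> \<theta> c'))
          \<le> (case q of (\<eta>, \<nu>, \<theta>) \<Rightarrow> ereal (penalty_obj n H \<omega> \<eta> \<nu> \<theta> c))"
      using p by (intro bexI[of _ p]) (simp_all add: obj)
  qed
  have bound: "?F c \<le> ereal (lambda_min H + 1 / (4 * c))" if "0 < c" for c
    unfolding penalty_sup_def
  proof (rule SUP_least, clarsimp)
    fix \<eta> \<nu> :: real and \<theta> assume "0 \<le> \<nu>" "\<theta> \<in> \<Theta>"
    let ?x = "sqrt (?Q \<eta> \<nu> \<theta>)"
    have "\<eta> \<le> lambda_min H + ?x"
      using eta_le_hs_norm_penalty_residual[OF assms(1) assms(3) psd, of \<theta> \<nu> \<eta>]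
        \<open>0 \<le> \<nu>\<close> \<open>\<theta> \<in> \<Theta>\<close> by simp
    \<comment> \<open>As \<open>?x\<close> squared is the penalty, the objective is at most
      \<open>lambda_min H + ?x - c * ?x\<^sup>2\<close>, and the resulting bound is uniform in the
      triple.\<close>
    then show "penalty_obj n H \<omega> \<eta> \<nu> \<theta> c \<le> lambda_min H + 1 / (4 * c)"
      using linear_minus_square_le[OF that, of ?x] \<open>\<theta> \<in> \<Theta>\<close> by (simp add: obj hs_norm_sq_nonneg)
  qed
  \<comment> \<open>The limit is taken in the extended reals; for empty \<open>\<Theta>\<close>
    every supremum, and so the limit, is minus infinity.\<close>
  have lim: "(?F \<longlongrightarrow> (INF c\<in>{0<..}. ?F c)) at_top"
    by (rule antimono_tendsto_INF_at_top) (rule anti)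
  have "((\<lambda>c. lambda_min H + 1 / (4 * c)) \<longlongrightarrow> lambda_min H) at_top"
    by real_asymp
  then have "((\<lambda>c. ereal (lambda_min H + 1 / (4 * c))) \<longlongrightarrow> ereal (lambda_min H)) at_top"
    by simp
  then have "(INF c\<in>{0<..}. ?F c) \<le> ereal (lambda_min H)"
    by (rule tendsto_le[OF trivial_limit_at_top_linorder _ lim])
      (rule eventually_mono[OF eventually_gt_at_top[of 0] bound])
  with lim show ?thesis by blast
qed

end
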